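(* A minimal divisive meadow admits transformation into simple fractions if and only if it is finite.
   Context: Let $\Sigma$ be the signature with constants $0,1$, binary operators $+$, $\cdot$, $/$ and unary operator $-$. Terms over $\Sigma$ are built as usual from infinitely many variables. A divisive meadow is a total algebra over $\Sigma$ satisfying the set $E$ of the following equations: $(x+y)+z=x+(y+z)$, $x+y=y+x$, $x+0=x$, $x+(-x)=0$, $(x\cdot y)\cdot z=x\cdot(y\cdot z)$, $x\cdot y=y\cdot x$, $x\cdot 1=x$, $x\cdot(y+z)=x\cdot y+x\cdot z$, $1/(1/x)=x$, $(x\cdot x)/x=x$, $x/y=x\cdot(1/y)$. A divisive meadow is finite if its carrier is finite, and minimal if it has no proper subalgebra (over $\Sigma$). A fraction is a term over $\Sigma$ whose outermost operator is $/$. A simple fraction is a fraction of which no proper subterm is a fraction. A divisive meadow $M$ admits transformation into simple fractions if, for each term $p$ over $\Sigma$, there exists a simple fraction $q$ such that $M\models p=q$. *)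

theory Defs
  imports "HOL-Algebra.Ring"
begin

datatype trm =
    Var nat
  | Zero ("\<^bold>0")
  | One ("\<^bold>1")
  | Plus trm trm (infixl "\<^bold>+" 65)
  | Times trm trm (infixl "\<^bold>*" 70)
  | Div trm trm (infixl "\<^bold>'/" 70)
  | Neg trm ("\<^bold>- _" [81] 80)

text \<open>The operations \<open>opp\<close> and \<open>quot\<close> are primitive. In particular, \<open>opp\<close> is not the
  \<open>a_inv\<close> that the library derives from addition.\<close>

record 'a sigma_alg = "'a ring" +
  opp :: "'a \<Rightarrow> 'a"
  quot :: "'a \<Rightarrow> 'a \<Rightarrow> 'a"

definition closed_under_ops :: "'a set \<Rightarrow> ('a, 'm) sigma_alg_scheme \<Rightarrow> bool" where
  "closed_under_ops S M \<longleftrightarrow>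
     \<zero>\<^bsub>M\<^esub> \<in> S \<and> \<one>\<^bsub>M\<^esub> \<in> S \<and>
     (\<forall>a\<in>S. \<forall>b\<in>S. a \<oplus>\<^bsub>M\<^esub> b \<in> S \<and> a \<otimes>\<^bsub>M\<^esub> b \<in> S \<and> quot M a b \<in> S) \<and>
     (\<forall>a\<in>S. opp M a \<in> S)"

definition sigma_algebra :: "('a, 'm) sigma_alg_scheme \<Rightarrow> bool" where
  "sigma_algebra M \<longleftrightarrow> closed_under_ops (carrier M) M"

definition subalgebra :: "'a set \<Rightarrow> ('a, 'm) sigma_alg_scheme \<Rightarrow> bool" where
  "subalgebra S M \<longleftrightarrow> S \<subseteq> carrier M \<and> closed_under_ops S M"

primrec interp :: "('a, 'm) sigma_alg_scheme \<Rightarrow> (nat \<Rightarrow> 'a) \<Rightarrow> trm \<Rightarrow> 'a" where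
  "interp M \<rho> (Var i) = \<rho> i"
| "interp M \<rho> \<^bold>0 = \<zero>\<^bsub>M\<^esub>"
| "interp M \<rho> \<^bold>1 = \<one>\<^bsub>M\<^esub>"
| "interp M \<rho> (p \<^bold>+ q) = interp M \<rho> p \<oplus>\<^bsub>M\<^esub> interp M \<rho> q"
| "interp M \<rho> (p \<^bold>* q) = interp M \<rho> p \<otimes>\<^bsub>M\<^esub> interp M \<rho> q"
| "interp M \<rho> (p \<^bold>/ q) = quot M (interp M \<rho> p) (interp M \<rho> q)"
| "interp M \<rho> (\<^bold>- p) = opp M (interp M \<rho> p)"

definition models_eq :: "('a, 'm) sigma_alg_scheme \<Rightarrow> trm \<Rightarrow> trm \<Rightarrow> bool" where
  "models_eq M p q \<longleftrightarrow> (\<forall>\<rho>. (\<forall>i. \<rho> i \<in> carrier M) \<longrightarrow> interp M \<rho> p = interp M \<rho> q)"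

definition meadow_eqs :: "(trm \<times> trm) set" where
  "meadow_eqs = (let x = Var 0; y = Var 1; z = Var 2 in
    { ((x \<^bold>+ y) \<^bold>+ z, x \<^bold>+ (y \<^bold>+ z)),
      (x \<^bold>+ y, y \<^bold>+ x),
      (x \<^bold>+ \<^bold>0, x),
      (x \<^bold>+ (\<^bold>- x), \<^bold>0),
      ((x \<^bold>* y) \<^bold>* z, x \<^bold>* (y \<^bold>* z)),
      (x \<^bold>* y, y \<^bold>* x),
      (x \<^bold>* \<^bold>1, x),
      (x \<^bold>* (y \<^bold>+ z), (x \<^bold>* y) \<^bold>+ (x \<^bold>* z)),
      (\<^bold>1 \<^bold>/ (\<^bold>1 \<^bold>/ x), x),
      ((x \<^bold>* x) \<^bold>/ x, x),
      (x \<^bold>/ y, x \<^bold>* (\<^bold>1 \<^bold>/ y)) })"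

definition divisive_meadow :: "('a, 'm) sigma_alg_scheme \<Rightarrow> bool" where
  "divisive_meadow M \<longleftrightarrow>
     sigma_algebra M \<and> (\<forall>(p, q) \<in> meadow_eqs. models_eq M p q)"

definition minimal_algebra :: "('a, 'm) sigma_alg_scheme \<Rightarrow> bool" where
  "minimal_algebra M \<longleftrightarrow> \<not> (\<exists>S. subalgebra S M \<and> S \<noteq> carrier M)"

primrec subterms :: "trm \<Rightarrow> trm set" where
  "subterms (Var i) = {Var i}"
| "subterms \<^bold>0 = {\<^bold>0}"
| "subterms \<^bold>1 = {\<^bold>1}"
| "subterms (p \<^bold>+ q) = {p \<^bold>+ q} \<union> subterms p \<union> subterms q"
| "subterms (p \<^bold>* q) = {p \<^bold>* q} \<union> subterms p \<union> subterms q"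
| "subterms (p \<^bold>/ q) = {p \<^bold>/ q} \<union> subterms p \<union> subterms q"
| "subterms (\<^bold>- p) = {\<^bold>- p} \<union> subterms p"

definition fraction :: "trm \<Rightarrow> bool" where
  "fraction p \<longleftrightarrow> (\<exists>r s. p = r \<^bold>/ s)"

definition simple_fraction :: "trm \<Rightarrow> bool" where
  "simple_fraction p \<longleftrightarrow> fraction p \<and> (\<forall>q \<in> subterms p - {p}. \<not> fraction q)"

definition admits_simple_fractions :: "('a, 'm) sigma_alg_scheme \<Rightarrow> bool" where
  "admits_simple_fractions M \<longleftrightarrow> (\<forall>p. \<exists>q. simple_fraction q \<and> models_eq M p q)"

end

theory Submission
  imports Defs
begin

text \<open>
  In a finite meadow the power maps \<open>x \<mapsto> x\<^sup>n\<close> cannot all be distinct, so some \<open>k\<close> satisfies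
  \<open>1 / x = x\<^sup>k\<close> for all \<open>x\<close>; this eliminates division from every term \<open>q\<close>, and \<open>q = q / 1\<close>.

  Conversely, the multiples of \<open>1\<close> in a meadow of positive characteristic form a finite
  subalgebra, so an infinite minimal meadow contains the integers. Suppose \<open>1 + 1 / x = r / s\<close>
  for integer polynomials \<open>r\<close> and \<open>s\<close>. At \<open>x = 0\<close> this gives \<open>1 = r(0) / s(0)\<close>,
  hence \<open>s(0) \<noteq> 0\<close>. Take an integer \<open>n > \<bar>s(0)\<bar>\<close>. Since \<open>s(n) \<equiv> s(0)\<close> modulo \<open>n\<close>, we
  have \<open>s(n) \<noteq> 0\<close>, so \<open>(n + 1) s(n) = n r(n)\<close> in the integers. Thus \<open>n\<close> divides \<open>s(n)\<close>
  and therefore \<open>s(0)\<close>, which is impossible.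
\<close>

section \<open>Meadows as commutative rings with a reciprocal\<close>

locale meadow = cring M for M :: "('a, 'm) sigma_alg_scheme" (structure) +
  assumes opp_eq: "x \<in> carrier M \<Longrightarrow> opp M x = \<ominus> x"
    and quot_closed [simp, intro]: "\<lbrakk>x \<in> carrier M; y \<in> carrier M\<rbrakk> \<Longrightarrow> quot M x y \<in> carrier M"
    and quot_quot: "x \<in> carrier M \<Longrightarrow> quot M \<one> (quot M \<one> x) = x"
    and quot_square: "x \<in> carrier M \<Longrightarrow> quot M (x \<otimes> x) x = x"
    and quot_eq: "\<lbrakk>x \<in> carrier M; y \<in> carrier M\<rbrakk> \<Longrightarrow> quot M x y = x \<otimes> quot M \<one> y"

text \<open>Gives access to the ring library: uniqueness of additive inverses identifies the
  primitive \<open>opp\<close> with the derived negation, so that only the division laws remain as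
  additional axioms.\<close>

lemma divisive_meadow_imp_meadow:
  fixes M :: "('a, 'm) sigma_alg_scheme" (structure)
  assumes "divisive_meadow M"
  shows "meadow M"
proof -
  have closed: "closed_under_ops (carrier M) M"
    using assms by (simp add: divisive_meadow_def sigma_algebra_def)
  have zero [simp]: "\<zero> \<in> carrier M" and one [simp]: "\<one> \<in> carrier M"
    using closed by (auto simp: closed_under_ops_def)
  have opp [simp]: "opp M a \<in> carrier M" if "a \<in> carrier M" for a
    using closed that by (auto simp: closed_under_ops_def)
  have bin [simp]: "a \<oplus> b \<in> carrier M" "a \<otimes> b \<in> carrier M" "quot M a b \<in> carrier M"
    if "a \<in> carrier M" "b \<in> carrier M" for a b
    using closed that by (auto simp: closed_under_ops_def)
  \<comment> \<open>The equations mention only the first three variables, so these assignments reach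
    all their instances. Equations in fewer variables are instantiated with repeated
    arguments.\<close>
  define v where "v x y z = (\<lambda>i::nat. if i = 0 then x else if i = 1 then y else z)" for x y z :: 'a
  have v [simp]: "v x y z 0 = x" "v x y z 1 = y" "v x y z (Suc 0) = y" "v x y z 2 = z" for x y z
    by (simp_all add: v_def)
  have eqs: "interp M (v x y z) p = interp M (v x y z) q"
    if "(p, q) \<in> meadow_eqs" "x \<in> carrier M" "y \<in> carrier M" "z \<in> carrier M" for p q x y z
    using assms that by (fastforce simp: divisive_meadow_def models_eq_def v_def)
  have a_assoc: "(x \<oplus> y) \<oplus> z = x \<oplus> (y \<oplus> z)"
    if "x \<in> carrier M" "y \<in> carrier M" "z \<in> carrier M" for x y z
    using eqs[of "(Var 0 \<^bold>+ Var 1) \<^bold>+ Var 2" "Var 0 \<^bold>+ (Var 1 \<^bold>+ Var 2)" x y z] that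
    by (simp add: meadow_eqs_def Let_def)
  have a_comm: "x \<oplus> y = y \<oplus> x" if "x \<in> carrier M" "y \<in> carrier M" for x y
    using eqs[of "Var 0 \<^bold>+ Var 1" "Var 1 \<^bold>+ Var 0" x y y] that by (simp add: meadow_eqs_def Let_def)
  have r_zero: "x \<oplus> \<zero> = x" if "x \<in> carrier M" for x
    using eqs[of "Var 0 \<^bold>+ \<^bold>0" "Var 0" x x x] that by (simp add: meadow_eqs_def Let_def)
  have opp_inverse: "x \<oplus> opp M x = \<zero>" if "x \<in> carrier M" for x
    using eqs[of "Var 0 \<^bold>+ (\<^bold>- Var 0)" "\<^bold>0" x x x] that by (simp add: meadow_eqs_def Let_def)
  have m_assoc: "(x \<otimes> y) \<otimes> z = x \<otimes> (y \<otimes> z)"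
    if "x \<in> carrier M" "y \<in> carrier M" "z \<in> carrier M" for x y z
    using eqs[of "(Var 0 \<^bold>* Var 1) \<^bold>* Var 2" "Var 0 \<^bold>* (Var 1 \<^bold>* Var 2)" x y z] that
    by (simp add: meadow_eqs_def Let_def)
  have m_comm: "x \<otimes> y = y \<otimes> x" if "x \<in> carrier M" "y \<in> carrier M" for x y
    using eqs[of "Var 0 \<^bold>* Var 1" "Var 1 \<^bold>* Var 0" x y y] that by (simp add: meadow_eqs_def Let_def)
  have r_one: "x \<otimes> \<one> = x" if "x \<in> carrier M" for x
    using eqs[of "Var 0 \<^bold>* \<^bold>1" "Var 0" x x x] that by (simp add: meadow_eqs_def Let_def)
  have distr: "x \<otimes> (y \<oplus> z) = x \<otimes> y \<oplus> x \<otimes> z"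
    if "x \<in> carrier M" "y \<in> carrier M" "z \<in> carrier M" for x y z
    using eqs[of "Var 0 \<^bold>* (Var 1 \<^bold>+ Var 2)" "(Var 0 \<^bold>* Var 1) \<^bold>+ (Var 0 \<^bold>* Var 2)" x y z] that
    by (simp add: meadow_eqs_def Let_def)
  have q_q: "quot M \<one> (quot M \<one> x) = x" if "x \<in> carrier M" for x
    using eqs[of "\<^bold>1 \<^bold>/ (\<^bold>1 \<^bold>/ Var 0)" "Var 0" x x x] that by (simp add: meadow_eqs_def Let_def)
  have q_sq: "quot M (x \<otimes> x) x = x" if "x \<in> carrier M" for x
    using eqs[of "(Var 0 \<^bold>* Var 0) \<^bold>/ Var 0" "Var 0" x x x] that by (simp add: meadow_eqs_def Let_def)
  have q_eq: "quot M x y = x \<otimes> quot M \<one> y" if "x \<in> carrier M" "y \<in> carrier M" for x y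
    using eqs[of "Var 0 \<^bold>/ Var 1" "Var 0 \<^bold>* (\<^bold>1 \<^bold>/ Var 1)" x y y] that
    by (simp add: meadow_eqs_def Let_def)
  interpret cring M
  proof (rule cringI)
    show "abelian_group M"
    proof (rule abelian_groupI)
      show "\<zero> \<oplus> x = x" if "x \<in> carrier M" for x
        using a_comm r_zero that by simp
      show "\<exists>y\<in>carrier M. y \<oplus> x = \<zero>" if "x \<in> carrier M" for x
        using that opp_inverse a_comm opp by metis
    qed (auto simp: a_assoc intro: a_comm)
    show "comm_monoid M"
      by (rule comm_monoidI) (use m_assoc m_comm r_one in auto)
    show "(x \<oplus> y) \<otimes> z = x \<otimes> z \<oplus> y \<otimes> z"
      if "x \<in> carrier M" "y \<in> carrier M" "z \<in> carrier M" for x y z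
      using that by (simp add: distr m_comm[of _ z])
  qed
  show ?thesis
  proof unfold_locales
    show "opp M x = \<ominus> x" if "x \<in> carrier M" for x
      using that minus_equality[of "opp M x" x] opp_inverse[of x] a_comm[of x "opp M x"] by simp
    show "quot M x y = x \<otimes> quot M \<one> y" if "x \<in> carrier M" "y \<in> carrier M" for x y
      using that by (rule q_eq)
  qed (simp_all add: q_q q_sq)
qed

section \<open>Division-free terms\<close>

primrec tpow :: "trm \<Rightarrow> nat \<Rightarrow> trm" where
  "tpow t 0 = \<^bold>1"
| "tpow t (Suc n) = tpow t n \<^bold>* t"

text \<open>Here \<open>k\<close> stands for an exponent with 1 / x = x^k throughout the meadow.
  Denominators are rewritten first, so nested quotients disappear as well.\<close>

primrec eliminate_div :: "nat \<Rightarrow> trm \<Rightarrow> trm" where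
  "eliminate_div k (Var i) = Var i"
| "eliminate_div k \<^bold>0 = \<^bold>0"
| "eliminate_div k \<^bold>1 = \<^bold>1"
| "eliminate_div k (p \<^bold>+ q) = eliminate_div k p \<^bold>+ eliminate_div k q"
| "eliminate_div k (p \<^bold>* q) = eliminate_div k p \<^bold>* eliminate_div k q"
| "eliminate_div k (p \<^bold>/ q) = eliminate_div k p \<^bold>* tpow (eliminate_div k q) k"
| "eliminate_div k (\<^bold>- p) = \<^bold>- eliminate_div k p"

primrec division_free :: "trm \<Rightarrow> bool" where
  "division_free (Var i) \<longleftrightarrow> True"
| "division_free \<^bold>0 \<longleftrightarrow> True"
| "division_free \<^bold>1 \<longleftrightarrow> True"
| "division_free (p \<^bold>+ q) \<longleftrightarrow> division_free p \<and> division_free q"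
| "division_free (p \<^bold>* q) \<longleftrightarrow> division_free p \<and> division_free q"
| "division_free (p \<^bold>/ q) \<longleftrightarrow> False"
| "division_free (\<^bold>- p) \<longleftrightarrow> division_free p"

lemma division_free_eliminate_div: "division_free (eliminate_div k p)"
proof -
  have "division_free (tpow t n)" if "division_free t" for t n
    using that by (induction n) auto
  then show ?thesis by (induction p) auto
qed

lemma size_subterms: "q \<in> subterms p \<Longrightarrow> size q \<le> size p"
  by (induction p) auto

lemma division_free_iff: "division_free p \<longleftrightarrow> (\<forall>q\<in>subterms p. \<not> fraction q)"
  by (induction p) (auto simp: fraction_def)

text \<open>By size, a quotient cannot occur inside its own arguments. Its proper subterms are
  therefore exactly the subterms of the two arguments.\<close>

lemma simple_fraction_Div: "simple_fraction (p \<^bold>/ q) \<longleftrightarrow> division_free p \<and> division_free q"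
proof -
  have "p \<^bold>/ q \<notin> subterms p" "p \<^bold>/ q \<notin> subterms q"
    using size_subterms[of "p \<^bold>/ q" p] size_subterms[of "p \<^bold>/ q" q] by auto
  then have "subterms (p \<^bold>/ q) - {p \<^bold>/ q} = subterms p \<union> subterms q"
    by auto
  then show ?thesis
    unfolding simple_fraction_def division_free_iff by (auto simp: fraction_def)
qed

text \<open>The value \<open>0\<close> of quotients is junk.\<close>

primrec int_eval :: "int \<Rightarrow> trm \<Rightarrow> int" where
  "int_eval n (Var i) = n"
| "int_eval n \<^bold>0 = 0"
| "int_eval n \<^bold>1 = 1"
| "int_eval n (p \<^bold>+ q) = int_eval n p + int_eval n q"
| "int_eval n (p \<^bold>* q) = int_eval n p * int_eval n q"
| "int_eval n (p \<^bold>/ q) = 0"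
| "int_eval n (\<^bold>- p) = - int_eval n p"

text \<open>A division-free term acts as an integer polynomial in \<open>n\<close>, so subtracting
  its constant term leaves a multiple of \<open>n\<close>. The junk value of quotients is constant
  and does no harm.\<close>

lemma dvd_int_eval_diff: "n dvd int_eval n p - int_eval 0 p"
proof (induction p)
  case (Plus p q)
  then show ?case
    using dvd_add[OF Plus] by (simp add: algebra_simps)
next
  case (Times p q)
  have "int_eval n p * int_eval n q - int_eval 0 p * int_eval 0 q =
    (int_eval n p - int_eval 0 p) * int_eval n q + int_eval 0 p * (int_eval n q - int_eval 0 q)"
    by (simp add: algebra_simps)
  then show ?case
    using Times by (simp add: dvd_add)
next
  case (Neg p)
  then show ?case
    by (simp add: dvd_diff_commute)
qed auto

section \<open>Reciprocals as powers\<close>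

context meadow
begin

abbreviation recip :: "'a \<Rightarrow> 'a" where
  "recip x \<equiv> quot M \<one> x"

abbreviation of_integer :: "int \<Rightarrow> 'a" where
  "of_integer k \<equiv> [k] \<cdot> \<one>"

lemma square_recip: "x \<in> carrier M \<Longrightarrow> x \<otimes> x \<otimes> recip x = x"
  by (metis m_closed quot_eq quot_square)

text \<open>This is \<open>square_recip\<close> at \<open>recip x\<close>, whose own reciprocal is
  \<open>x\<close>.\<close>

lemma recip_square: "x \<in> carrier M \<Longrightarrow> recip x \<otimes> recip x \<otimes> x = recip x"
  by (metis one_closed quot_closed quot_quot square_recip)

lemma recip_one: "recip \<one> = \<one>"
  using square_recip[of \<one>] by simp

lemma recip_zero: "recip \<zero> = \<zero>"
  using recip_square[of \<zero>] by simp

text \<open>Cancelling a factor needs a second one to remain, since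
  \<open>x \<otimes> recip x\<close> may differ from \<open>\<one>\<close>.\<close>

lemma Suc_pow_recip: "x \<in> carrier M \<Longrightarrow> x [^] Suc (Suc n) \<otimes> recip x = x [^] Suc n"
  using square_recip[of x] by (simp add: m_assoc)

text \<open>The factor \<open>2\<close> keeps the exponent positive: for \<open>j = i + 1\<close> the equation \<open>recip x = x\<^sup>0\<close>
  fails at \<open>x = 0\<close>.\<close>

lemma recip_eq_power:
  fixes i j :: nat
  assumes x: "x \<in> carrier M" and eq: "x [^] i = x [^] j" and "i < j"
  shows "recip x = x [^] (2 * (j - i) - 1)"
proof -
  define d where "d = j - i"
  have "d > 0" using \<open>i < j\<close> by (simp add: d_def)
  \<comment> \<open>Multiplying by \<open>recip x\<close> lowers both exponents by one, down to
    \<open>i = 1\<close>, which is the claim. If \<open>i = 0\<close>, multiplying by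
    \<open>x\<close> gives the claim.\<close>
  have cancel: "x [^] Suc d = x" if "x [^] i = x [^] (i + d)" for i
    using that
  proof (induction i)
    case 0
    then have "x [^] d = \<one>"
      by simp
    then show ?case
      using x by simp
  next
    case (Suc i)
    show ?case
    proof (cases i)
      case 0
      with Suc.prems x show ?thesis by simp
    next
      case (Suc m)
      have "x [^] Suc m = x [^] Suc (Suc m) \<otimes> recip x"
        using x by (simp only: Suc_pow_recip)
      also have "\<dots> = x [^] Suc (Suc (m + d)) \<otimes> recip x"
        using Suc.prems Suc by simp
      also have "\<dots> = x [^] (Suc m + d)"
        using x by (simp only: Suc_pow_recip add_Suc)
      finally show ?thesis
        using Suc.IH Suc by simp
    qed
  qed
  have 1: "x [^] Suc d = x"
    using cancel[of i] eq \<open>i < j\<close> by (simp add: d_def)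
  have "x [^] Suc (2 * d) = x [^] Suc d \<otimes> x [^] d"
    using x by (simp only: nat_pow_mult) (simp add: mult_2)
  also have "\<dots> = x [^] Suc d"
    using x 1 by (simp add: m_comm)
  finally have 2: "x [^] Suc (2 * d) = x"
    using 1 by simp
  obtain e where e: "2 * d = Suc (Suc e)"
    using \<open>d > 0\<close> that[of "2 * d - 2"] by simp
  \<comment> \<open>Replacing \<open>x\<close> by its power with exponent 2d + 1 leaves enough
    factors to cancel both reciprocals, with exponent 2d - 1 remaining.\<close>
  have "recip x = recip x \<otimes> recip x \<otimes> x [^] Suc (2 * d)"
    using recip_square[OF x] 2 by simp
  also have "\<dots> = x [^] Suc (Suc (Suc e)) \<otimes> recip x \<otimes> recip x"
    using x by (simp only: e) (simp add: m_comm m_assoc)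
  also have "\<dots> = x [^] Suc e"
    using x by (simp only: Suc_pow_recip)
  finally show ?thesis
    using e by (simp add: d_def)
qed

lemma finite_recip_eq_power:
  assumes "finite (carrier M)"
  obtains k where "\<And>x. x \<in> carrier M \<Longrightarrow> recip x = x [^] (k :: nat)"
proof -
  \<comment> \<open>Restriction makes the power maps extensional, and a finite carrier has only
    finitely many such self-maps. Two equal maps agree at every \<open>x\<close> at once, so one
    \<open>k\<close> serves all elements.\<close>
  let ?f = "\<lambda>n::nat. restrict (\<lambda>x. x [^] n) (carrier M)"
  have "range ?f \<subseteq> carrier M \<rightarrow>\<^sub>E carrier M"
    by auto
  then have "finite (range ?f)"
    using finite_PiE[OF assms, of "\<lambda>_. carrier M"] assms finite_subset by blast
  then have "\<not> inj ?f"
    using finite_imageD infinite_UNIV_nat by blast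
  then obtain i j where "i < j" and eq: "?f i = ?f j"
    unfolding inj_def by (metis linorder_neq_iff)
  have "x [^] i = x [^] j" if "x \<in> carrier M" for x
    using fun_cong[OF eq, of x] that by simp
  with \<open>i < j\<close> show thesis
    using that recip_eq_power by blast
qed

lemma interp_closed: "(\<And>i. \<rho> i \<in> carrier M) \<Longrightarrow> interp M \<rho> p \<in> carrier M"
  by (induction p) (auto simp: opp_eq)

lemma interp_eliminate_div:
  assumes "\<And>x. x \<in> carrier M \<Longrightarrow> recip x = x [^] k" and \<rho>: "\<And>i. \<rho> i \<in> carrier M"
  shows "interp M \<rho> (eliminate_div k p) = interp M \<rho> p"
proof -
  have tpow: "interp M \<rho> (tpow t n) = interp M \<rho> t [^] n" for t n
    by (induction n) auto
  show ?thesis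
  proof (induction p)
    case (Div p q)
    then show ?case
      using assms(1) interp_closed[OF \<rho>]
      by (simp add: tpow quot_eq[of "interp M \<rho> p"])
  qed auto
qed

lemma finite_imp_admits_simple_fractions:
  assumes "finite (carrier M)"
  shows "admits_simple_fractions M"
proof -
  obtain k where k: "\<And>x. x \<in> carrier M \<Longrightarrow> recip x = x [^] (k :: nat)"
    using finite_recip_eq_power[OF assms] by blast
  have "models_eq M p (eliminate_div k p \<^bold>/ \<^bold>1)" for p
    unfolding models_eq_def
    using interp_eliminate_div[of k _ p, OF k] interp_closed[of _ p]
    by (simp add: quot_eq recip_one)
  moreover have "simple_fraction (eliminate_div k p \<^bold>/ \<^bold>1)" for p
    by (simp add: simple_fraction_Div division_free_eliminate_div)
  ultimately show ?thesis
    unfolding admits_simple_fractions_def by blast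
qed

section \<open>Integers in a meadow and the converse direction\<close>

lemma of_integer_0 [simp]: "of_integer 0 = \<zero>"
  by (simp add: add_pow_int_ge)

lemma of_integer_1 [simp]: "of_integer 1 = \<one>"
  by (simp add: add_pow_int_ge)

lemma of_integer_add: "of_integer (m + n) = of_integer m \<oplus> of_integer n"
  by (rule add.int_pow_mult) simp

lemma of_integer_minus: "of_integer (- m) = \<ominus> of_integer m"
  by (rule add.int_pow_neg) simp

lemma of_integer_mult: "of_integer (m * n) = of_integer m \<otimes> of_integer n"
proof -
  have "of_integer m \<otimes> of_integer n = [m] \<cdot> (of_integer n)"
    by (simp add: add_pow_ldistr_int)
  also have "\<dots> = of_integer (n * m)"
    by (rule add.int_pow_pow) simp
  finally show ?thesis
    by (simp add: mult.commute)
qed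

text \<open>The constant assignment matches \<open>int_eval\<close>, which gives all variables the
  same value.\<close>

lemma interp_of_integer:
  "division_free p \<Longrightarrow> interp M (\<lambda>_. of_integer n) p = of_integer (int_eval n p)"
  by (induction p)
    (auto simp: of_integer_add of_integer_mult of_integer_minus opp_eq)

text \<open>Only division goes beyond ring arithmetic. Two powers of a given integer coincide by
  finiteness, so its reciprocal is one of its powers and again an integer.\<close>

lemma finite_range_of_integer_imp_subalgebra:
  assumes "finite (range of_integer)"
  shows "subalgebra (range of_integer) M"
proof -
  have pow: "of_integer m [^] n = of_integer (m ^ n)" for m and n :: nat
    by (induction n) (simp_all add: of_integer_mult m_comm)
  have recip: "recip (of_integer m) \<in> range of_integer" for m
  proof -
    let ?f = "\<lambda>n::nat. of_integer m [^] n"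
    have "range ?f \<subseteq> range of_integer"
      using pow by auto
    then have "finite (range ?f)"
      using assms finite_subset by blast
    then have "\<not> inj ?f"
      using finite_imageD infinite_UNIV_nat by blast
    then obtain i j where "i < j" and eq: "?f i = ?f j"
      unfolding inj_def by (metis linorder_neq_iff)
    then show ?thesis
      using recip_eq_power[of "of_integer m" i j] by (simp add: pow)
  qed
  have quot: "quot M (of_integer m) (of_integer n) \<in> range of_integer" for m n
  proof -
    obtain k where "recip (of_integer n) = of_integer k"
      using recip by blast
    then show ?thesis
      using quot_eq[of "of_integer m" "of_integer n"] of_integer_mult[of m k] by (metis add.int_pow_closed one_closed rangeI)
  qed
  show ?thesis
    unfolding subalgebra_def closed_under_ops_def
  proof (intro conjI ballI)
    show "range of_integer \<subseteq> carrier M" by auto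
    show "\<zero> \<in> range of_integer" by (rule range_eqI[of _ _ 0]) simp
    show "\<one> \<in> range of_integer" by (rule range_eqI[of _ _ 1]) simp
    fix a b
    assume "a \<in> range of_integer"
    then obtain m where a: "a = of_integer m" by blast
    show "opp M a \<in> range of_integer"
      by (simp add: a opp_eq flip: of_integer_minus)
    assume "b \<in> range of_integer"
    then obtain n where b: "b = of_integer n" by blast
    show "a \<oplus> b \<in> range of_integer" "a \<otimes> b \<in> range of_integer" "quot M a b \<in> range of_integer"
      using quot by (simp_all add: a b flip: of_integer_add of_integer_mult)
  qed
qed

text \<open>If two integers coincide, reduction modulo their difference makes the image finite. It
  is then a subalgebra, and minimality forces it to be the whole infinite carrier.\<close>

lemma minimal_infinite_inj_of_integer:
  assumes "minimal_algebra M" and "infinite (carrier M)"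
  shows "inj of_integer"
proof (rule ccontr)
  assume "\<not> inj of_integer"
  then obtain i j where "i < j" and eq: "of_integer i = of_integer j"
    unfolding inj_def by (metis linorder_neq_iff)
  define n where "n = j - i"
  have "n > 0" and "of_integer n = \<zero>"
    using \<open>i < j\<close> eq of_integer_add[of j "- i"] by (simp_all add: n_def of_integer_minus r_neg)
  have "of_integer k = of_integer (k mod n)" for k
  proof -
    have "of_integer k = of_integer (n * (k div n) + k mod n)"
      by simp
    also have "\<dots> = of_integer (k mod n)"
      using \<open>of_integer n = \<zero>\<close> by (simp only: of_integer_add of_integer_mult) simp
    finally show ?thesis .
  qed
  then have "of_integer k \<in> of_integer ` {0..<n}" for k
    using \<open>n > 0\<close> by (metis Euclidean_Rings.pos_mod_bound Euclidean_Rings.pos_mod_sign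
        atLeastLessThan_iff imageI)
  then have "range of_integer \<subseteq> of_integer ` {0..<n}"
    by blast
  then have "finite (range of_integer)"
    using finite_subset by blast
  with finite_range_of_integer_imp_subalgebra assms show False
    unfolding minimal_algebra_def by metis
qed

lemma inj_of_integer_imp_not_admits_simple_fractions:
  assumes inj: "inj of_integer"
  shows "\<not> admits_simple_fractions M"
proof
  assume "admits_simple_fractions M"
  then obtain q where "simple_fraction q" and q: "models_eq M (\<^bold>1 \<^bold>+ \<^bold>1 \<^bold>/ Var 0) q"
    unfolding admits_simple_fractions_def by blast
  then obtain r s where "q = r \<^bold>/ s" and "division_free r" "division_free s"
    unfolding simple_fraction_def fraction_def
    using simple_fraction_Div \<open>simple_fraction q\<close> by (metis fraction_def)
  define A where "A n = of_integer (int_eval n r)" for n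
  define B where "B n = of_integer (int_eval n s)" for n
  have [simp]: "A n \<in> carrier M" "B n \<in> carrier M" for n
    by (simp_all add: A_def B_def)
  have eq: "\<one> \<oplus> recip (of_integer n) = A n \<otimes> recip (B n)" for n
  proof -
    have "interp M (\<lambda>_. of_integer n) (\<^bold>1 \<^bold>+ \<^bold>1 \<^bold>/ Var 0) = interp M (\<lambda>_. of_integer n) q"
      using q[unfolded models_eq_def, rule_format, of "\<lambda>_. of_integer n"] by simp
    then show ?thesis
      using \<open>division_free r\<close> \<open>division_free s\<close>
      by (simp add: \<open>q = _\<close> interp_of_integer A_def B_def quot_eq[of "of_integer _" "of_integer _"])
  qed
  have "\<one> \<noteq> \<zero>"
    using inj_onD[OF inj, of 1 0] by auto
  have s0: "int_eval 0 s \<noteq> 0"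
  proof
    assume "int_eval 0 s = 0"
    then have "B 0 = \<zero>"
      by (simp add: B_def)
    \<comment> \<open>Since 1 / 0 = 0, the right-hand side of \<open>eq\<close> at 0 vanishes while
      the left-hand side is \<open>\<one>\<close>.\<close>
    then show False
      using eq[of 0] \<open>\<one> \<noteq> \<zero>\<close> by (simp add: recip_zero)
  qed
  define n where "n = \<bar>int_eval 0 s\<bar> + 1"
  have "n > 0" by (simp add: n_def)
  have "\<not> n dvd int_eval 0 s"
    using s0 dvd_imp_le_int[of "int_eval 0 s" n] by (auto simp: n_def)
  then have ndvd: "\<not> n dvd int_eval n s"
    using dvd_diff[OF _ dvd_int_eval_diff[of n s], of "int_eval n s"] by auto
  then have "int_eval n s \<noteq> 0"
    by auto
  define N where "N = of_integer n"
  have [simp]: "N \<in> carrier M" by (simp add: N_def)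
  \<comment> \<open>\<open>N\<close> and \<open>B n\<close> are not known to be invertible in
    \<open>M\<close>. Multiplying by both squares still removes the reciprocals, by
    \<open>square_recip\<close>.\<close>
  have "(B n \<otimes> B n) \<otimes> (N \<otimes> N \<oplus> N) = (B n \<otimes> B n) \<otimes> (N \<otimes> N \<otimes> (\<one> \<oplus> recip N))"
    by (simp add: r_distr square_recip)
  also have "\<dots> = (B n \<otimes> B n) \<otimes> (N \<otimes> N \<otimes> (A n \<otimes> recip (B n)))"
    using eq[of n] by (simp add: N_def)
  also have "\<dots> = N \<otimes> N \<otimes> A n \<otimes> (B n \<otimes> B n \<otimes> recip (B n))"
    by (simp add: m_ac)
  also have "\<dots> = N \<otimes> N \<otimes> A n \<otimes> B n"
    by (simp add: square_recip)
  finally have "of_integer ((int_eval n s * int_eval n s) * (n * n + n)) =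
      of_integer (n * n * int_eval n r * int_eval n s)"
    by (simp only: of_integer_mult of_integer_add A_def B_def N_def)
  \<comment> \<open>Injectivity moves the equation to the integers, where the nonzero common factor
    \<open>n * int_eval n s\<close> can be cancelled.\<close>
  then have "(int_eval n s * int_eval n s) * (n * n + n) = n * n * int_eval n r * int_eval n s"
    using inj by (blast dest: injD)
  then have "(n * int_eval n s) * (int_eval n s * (n + 1)) = (n * int_eval n s) * (n * int_eval n r)"
    by (simp add: algebra_simps)
  then have "int_eval n s * (n + 1) = n * int_eval n r"
    using \<open>n > 0\<close> \<open>int_eval n s \<noteq> 0\<close> by simp
  then have "int_eval n s = n * (int_eval n r - int_eval n s)"
    by (simp add: algebra_simps)
  then show False
    using ndvd by (metis dvd_triv_left)
qed

end

theorem corollary2: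
  fixes M :: "('a, 'm) sigma_alg_scheme"
  assumes "divisive_meadow M" and "minimal_algebra M"
  shows "admits_simple_fractions M \<longleftrightarrow> finite (carrier M)"
proof -
  interpret meadow M
    using assms(1) by (rule divisive_meadow_imp_meadow)
  show ?thesis
    using finite_imp_admits_simple_fractions minimal_infinite_inj_of_integer[OF assms(2)]
      inj_of_integer_imp_not_admits_simple_fractions by blast
qed

end
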